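(* Let $H$ be a finite $3$-uniform hypergraph on $n$ vertices that is $f_0$-sparse, where $f_0(k)=\lceil k/2\rceil$; that is, for every $k\in\{4,5,\dots,n\}$, every $k$-element set of vertices contains at most $\lceil k/2\rceil$ hyperedges. Then $H$ is metric.
   Context: Given a metric space $M=(X,\rho)$ and three distinct points $x,y,z\in X$, $y$ is said to be between $x$ and $z$ if $\rho(x,z)=\rho(x,y)+\rho(y,z)$; the triple $\{x,y,z\}$ is collinear if one of its points is between the other two. The hypergraph $H_M$ associated with $M$ is the $3$-uniform hypergraph whose vertices are the points of $M$ and whose hyperedges are exactly the collinear triples of $M$. A $3$-uniform hypergraph $H$ is metric if there is a metric space $M$ with $H_M=H$. A set $X$ of vertices contains (induces) a hyperedge $e$ if $e\subseteq X$. *)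

theory Defs
  imports "HOL-Analysis.Analysis"
begin

text \<open>A hypergraph is a pair of a vertex set and a set of hyperedges.\<close>

type_synonym 'a hypergraph = "'a set \<times> 'a set set"

definition three_uniform :: "'a hypergraph \<Rightarrow> bool" where
  "three_uniform H \<longleftrightarrow> (\<forall>e \<in> snd H. e \<subseteq> fst H \<and> card e = 3)"

text \<open>\<open>lies_between d x y z\<close> says that the middle argument \<open>y\<close> lies between \<open>x\<close> and \<open>z\<close>.
  The names \<open>between\<close> and \<open>collinear\<close> of the library are the affine notions.\<close>

definition lies_between :: "('a \<Rightarrow> 'a \<Rightarrow> real) \<Rightarrow> 'a \<Rightarrow> 'a \<Rightarrow> 'a \<Rightarrow> bool" where
  "lies_between d x y z \<longleftrightarrow>
     x \<noteq> y \<and> y \<noteq> z \<and> x \<noteq> z \<and> d x z = d x y + d y z"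

definition collinear_triple :: "('a \<Rightarrow> 'a \<Rightarrow> real) \<Rightarrow> 'a set \<Rightarrow> bool" where
  "collinear_triple d e \<longleftrightarrow> (\<exists>x y z. e = {x, y, z} \<and> lies_between d x y z)"

definition hypergraph_of_metric :: "'a set \<Rightarrow> ('a \<Rightarrow> 'a \<Rightarrow> real) \<Rightarrow> 'a hypergraph" where
  "hypergraph_of_metric X d = (X, {e. e \<subseteq> X \<and> collinear_triple d e})"

definition metric_hypergraph :: "'a hypergraph \<Rightarrow> bool" where
  "metric_hypergraph H \<longleftrightarrow> (\<exists>X d. Metric_space X d \<and> hypergraph_of_metric X d = H)"

definition sparse_hypergraph :: "(nat \<Rightarrow> nat) \<Rightarrow> 'a hypergraph \<Rightarrow> bool" where
  "sparse_hypergraph f H \<longleftrightarrow>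
     (\<forall>k \<in> {4..card (fst H)}. \<forall>S. S \<subseteq> fst H \<and> card S = k \<longrightarrow>
        card {e \<in> snd H. e \<subseteq> S} \<le> f k)"

definition f0 :: "nat \<Rightarrow> nat" where
  "f0 k = nat \<lceil>real k / 2\<rceil>"

end

theory Submission
  imports Defs
begin

text \<open>The metric is built one vertex at a time. By sparsity \<open>m\<close> edges inside \<open>k\<close> vertices satisfy
  \<open>2 m \<le> k + 1\<close>, so by counting degrees every induced subhypergraph has a vertex \<open>v\<close> of degree at
  most 1. If \<open>v\<close> has the single edge \<open>{v, a, b}\<close>, then \<open>v\<close> is placed far away on a geodesic that
  continues from \<open>a\<close> through \<open>b\<close>, in general position otherwise. This is possible unless some point
  already lies between \<open>a\<close> and \<open>b\<close>, which is excluded by only ever using long sides that lie in a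
  single edge of the whole hypergraph. Hence \<open>v a\<close> or \<open>v b\<close> must lie in no other edge. If this
  fails there are three edges \<open>{v, a, b}\<close>, \<open>{v, a, w}\<close>, \<open>{v, b, u}\<close> on five vertices; sparsity
  leaves room for essentially one such configuration, and the construction starts from it, with
  \<open>a b\<close> as the long side of \<open>{v, a, b}\<close>.\<close>

section \<open>Realizations and one-point extensions\<close>

text \<open>The long side \<open>x z\<close> is reserved with respect to all of \<open>E\<close>,
  not only the edges inside \<open>U\<close>. Hence no vertex added later can have an edge through
  \<open>x\<close> and \<open>z\<close>.\<close>

definition realizes :: "'a set set \<Rightarrow> 'a set \<Rightarrow> ('a \<Rightarrow> 'a \<Rightarrow> real) \<Rightarrow> bool" where
  "realizes E U d \<longleftrightarrow> Metric_space U d \<and>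
     (\<forall>x\<in>U. \<forall>y\<in>U. \<forall>z\<in>U. lies_between d x y z \<longrightarrow>
        {x, y, z} \<in> E \<and> (\<forall>e\<in>E. x \<in> e \<longrightarrow> z \<in> e \<longrightarrow> e = {x, y, z})) \<and>
     (\<forall>e\<in>E. e \<subseteq> U \<longrightarrow> collinear_triple d e)"

definition realizable :: "'a set set \<Rightarrow> 'a set \<Rightarrow> bool" where
  "realizable E U \<longleftrightarrow> (\<exists>d. realizes E U d)"

definition one_point_extension :: "'a \<Rightarrow> ('a \<Rightarrow> real) \<Rightarrow> ('a \<Rightarrow> 'a \<Rightarrow> real) \<Rightarrow> 'a \<Rightarrow> 'a \<Rightarrow> real" where
  "one_point_extension v g d x y =
     (if x = v then if y = v then 0 else g y else if y = v then g x else d x y)"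

text \<open>\<open>g\<close> is a Katetov function: \<open>lip\<close> is the triangle inequality
  for a side ending at \<open>v\<close>, \<open>kat\<close> the one for a path through
  \<open>v\<close>. \<open>g\<close> is nonnegative even off \<open>U\<close> because
  \<open>Metric_space\<close> demands nonnegative distances on the whole type.\<close>

lemma Metric_space_one_point_extension:
  assumes "Metric_space U d" "v \<notin> U" "\<And>c. g c \<ge> 0" "\<And>c. c \<in> U \<Longrightarrow> g c > 0"
    and lip: "\<And>x y. x \<in> U \<Longrightarrow> y \<in> U \<Longrightarrow> g x \<le> g y + d x y"
    and kat: "\<And>x y. x \<in> U \<Longrightarrow> y \<in> U \<Longrightarrow> d x y < g x + g y"
  shows "Metric_space (insert v U) (one_point_extension v g d)"
proof -
  interpret Metric_space U d by fact
  show ?thesis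
  proof
    fix x y z
    show "0 \<le> one_point_extension v g d x y"
      using assms(3) by (auto simp: one_point_extension_def)
    show "one_point_extension v g d x y = one_point_extension v g d y x"
      by (auto simp: one_point_extension_def commute)
    assume "x \<in> insert v U" "y \<in> insert v U"
    then show "(one_point_extension v g d x y = 0) = (x = y)"
      using assms(2) assms(4)[of x] assms(4)[of y] by (auto simp: one_point_extension_def)
    assume "z \<in> insert v U"
    then show "one_point_extension v g d x z
        \<le> one_point_extension v g d x y + one_point_extension v g d y z"
      using \<open>x \<in> _\<close> \<open>y \<in> _\<close> assms(2,3) lip[of z y] lip[of x y] kat[of x z] triangle[of x y z]
        commute[of z y]
      by (auto simp: one_point_extension_def)
  qed
qed

text \<open>Strictness of \<open>kat\<close> keeps \<open>v\<close> from being a middle point, so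
  every new betweenness has \<open>v\<close> as an end and is an equality in \<open>lip\<close>.
  Such equalities must come from edges with a reserved long side (\<open>new\<close>), and every new
  edge must yield one (\<open>new_edge\<close>).\<close>

lemma realizable_insert:
  fixes g :: "'a \<Rightarrow> real"
  assumes d: "realizes E U d" and v: "v \<notin> U" and g0: "\<And>c. g c \<ge> 0"
    and gpos: "\<And>c. c \<in> U \<Longrightarrow> g c > 0"
    and lip: "\<And>x y. x \<in> U \<Longrightarrow> y \<in> U \<Longrightarrow> g x \<le> g y + d x y"
    and kat: "\<And>x y. x \<in> U \<Longrightarrow> y \<in> U \<Longrightarrow> d x y < g x + g y"
    and new: "\<And>x y. x \<in> U \<Longrightarrow> y \<in> U \<Longrightarrow> x \<noteq> y \<Longrightarrow> g x = g y + d x y \<Longrightarrow>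
        {v, y, x} \<in> E \<and> (\<forall>e\<in>E. v \<in> e \<longrightarrow> x \<in> e \<longrightarrow> e = {v, y, x})"
    and new_edge: "\<And>e. e \<in> E \<Longrightarrow> v \<in> e \<Longrightarrow> e \<subseteq> insert v U \<Longrightarrow>
        \<exists>x\<in>U. \<exists>y\<in>U. x \<noteq> y \<and> e = {v, y, x} \<and> g x = g y + d x y"
  shows "realizable E (insert v U)"
  unfolding realizable_def
proof
  let ?d = "one_point_extension v g d"
  interpret Metric_space U d using d by (simp add: realizes_def)
  have old: "{x, y, z} \<in> E \<and> (\<forall>e\<in>E. x \<in> e \<longrightarrow> z \<in> e \<longrightarrow> e = {x, y, z})"
    if "x \<in> U" "y \<in> U" "z \<in> U" "lies_between d x y z" for x y z
    using d that by (simp add: realizes_def)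
  have old_edge: "collinear_triple d e" if "e \<in> E" "e \<subseteq> U" for e
    using d that by (simp add: realizes_def)
  have metric: "Metric_space (insert v U) ?d"
    by (intro Metric_space_one_point_extension Metric_space_axioms v g0 gpos lip kat)
  have ext: "lies_between ?d x y z \<longleftrightarrow> lies_between d x y z" if "x \<noteq> v" "y \<noteq> v" "z \<noteq> v" for x y z
    using that by (simp add: lies_between_def one_point_extension_def)
  have between: "{x, y, z} \<in> E \<and> (\<forall>e\<in>E. x \<in> e \<longrightarrow> z \<in> e \<longrightarrow> e = {x, y, z})"
    if xyz: "x \<in> insert v U" "y \<in> insert v U" "z \<in> insert v U" "lies_between ?d x y z" for x y z
    proof -
      consider "x \<noteq> v" "y \<noteq> v" "z \<noteq> v" | "x = v" | "y = v" | "z = v" by blast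
      then show ?thesis
      proof cases
        case 1
        then show ?thesis using xyz ext old by blast
      next
        case 2
        then have "g z = g y + d z y" "y \<in> U" "z \<in> U" "z \<noteq> y"
          using xyz by (auto simp: lies_between_def one_point_extension_def commute)
        with new 2 show ?thesis by blast
      next
        case 3
        then have "d x z = g x + g z" "x \<in> U" "z \<in> U"
          using xyz by (auto simp: lies_between_def one_point_extension_def)
        with kat[of x z] show ?thesis by simp
      next
        case 4
        then have "g x = g y + d x y" "y \<in> U" "x \<in> U" "x \<noteq> y"
          using xyz by (auto simp: lies_between_def one_point_extension_def)
        from new[OF this(3,2,4,1)] 4 show ?thesis by (auto simp: insert_commute)
      qed
    qed
  have edge: "collinear_triple ?d e" if e: "e \<in> E" "e \<subseteq> insert v U" for e
  proof (cases "v \<in> e")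
    case True
    then obtain x y where xy: "x \<in> U" "y \<in> U" "x \<noteq> y" "e = {v, y, x}" "g x = g y + d x y"
      using new_edge e by blast
    then have "lies_between ?d v y x"
      using v by (auto simp: lies_between_def one_point_extension_def commute)
    then show ?thesis unfolding collinear_triple_def using xy by blast
  next
    case False
    then have "collinear_triple d e" using e old_edge by blast
    then obtain x y z where xyz: "e = {x, y, z}" "lies_between d x y z"
      unfolding collinear_triple_def by blast
    then have "lies_between ?d x y z" using False ext by auto
    then show ?thesis unfolding collinear_triple_def using xyz by blast
  qed
  show "realizes E (insert v U) ?d"
    using metric between edge by (simp add: realizes_def)
qed

lemma (in Metric_space) finite_bounded:
  assumes "finite M"
  shows "\<exists>K>0. \<forall>x\<in>M. \<forall>y\<in>M. d x y < K"
proof (intro exI conjI ballI)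
  \<comment> \<open>The sum of all distances bounds each of them; adding 1 makes the bound strict,
    and positive even for empty \<open>M\<close>.\<close>
  let ?S = "\<Sum>p\<in>M \<times> M. d (fst p) (snd p)"
  have "?S \<ge> 0" by (simp add: sum_nonneg)
  then show "1 + ?S > 0" by linarith
  show "d x y < 1 + ?S" if "x \<in> M" "y \<in> M" for x y
    using member_le_sum[of "(x, y)" "M \<times> M" "\<lambda>p. d (fst p) (snd p)"] that assms by simp
qed

text \<open>If \<open>v\<close> has one common distance \<open>K\<close> to all of \<open>U\<close>,
  larger than every distance in \<open>U\<close>, then \<open>lip\<close> is strict for distinct
  points and no betweenness involves \<open>v\<close>.\<close>

lemma realizable_insert_free:
  assumes "realizable E U" "finite U" "v \<notin> U" "\<And>e. e \<in> E \<Longrightarrow> v \<in> e \<Longrightarrow> \<not> e \<subseteq> insert v U"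
  shows "realizable E (insert v U)"
proof -
  obtain d where d: "realizes E U d"
    using assms(1) unfolding realizable_def by blast
  interpret Metric_space U d using d by (simp add: realizes_def)
  obtain K where K: "K > 0" "\<forall>x\<in>U. \<forall>y\<in>U. d x y < K"
    using finite_bounded[OF assms(2)] by blast
  show ?thesis
  proof (rule realizable_insert[where g = "\<lambda>_. K" and d = d])
    show "d x y < K + K" if "x \<in> U" "y \<in> U" for x y using K(1) K(2) that by (smt (verit))
    show "K \<ge> 0" "K > 0" using K(1) by simp_all
    show "K \<le> K + d x y" for x y by simp
    show "{v, y, x} \<in> E \<and> (\<forall>e\<in>E. v \<in> e \<longrightarrow> x \<in> e \<longrightarrow> e = {v, y, x})"
      if "x \<in> U" "y \<in> U" "x \<noteq> y" "K = K + d x y" for x y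
      using that by simp
    show "\<exists>x\<in>U. \<exists>y\<in>U. x \<noteq> y \<and> e = {v, y, x} \<and> K = K + d x y"
      if "e \<in> E" "v \<in> e" "e \<subseteq> insert v U" for e
      using assms(4) that by blast
  qed (fact d assms(3))+
qed

section \<open>Extending a geodesic by a new vertex\<close>

text \<open>Up to an additive constant, \<open>f\<close> will be the distance from a new vertex
  placed beyond \<open>b\<close> on a geodesic from \<open>a\<close>. Equality at the pair
  \<open>a\<close>, \<open>b\<close> alone rules out any other new betweenness.\<close>

lemma (in Metric_space) ex_nonexpansive_strict:
  assumes "finite M" "a \<in> M" "b \<in> M" "a \<noteq> b"
    and nobetw: "\<And>c. c \<in> M \<Longrightarrow> \<not> lies_between d a c b"
  shows "\<exists>f. f a = f b + d a b \<and> (\<forall>x\<in>M. \<forall>y\<in>M. f x \<le> f y + d x y) \<and>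
    (\<forall>x\<in>M. \<forall>y\<in>M. f x = f y + d x y \<longrightarrow> x \<noteq> y \<longrightarrow> x = a \<and> y = b)"
proof -
  \<comment> \<open>\<open>F c\<close> is the largest nonexpansive function with value 0 at \<open>b\<close> and the least possible value
    at \<open>c\<close>, given the value \<open>d a b\<close> at \<open>a\<close>; averaging over \<open>c\<close> makes all inequalities strict.\<close>
  define F where "F c x = min (d b x) (d a b - d c a + d c x)" for c x
  define f where "f x = (\<Sum>c\<in>M. F c x) / card M" for x
  have cpos: "real (card M) > 0" using assms by (auto simp: card_gt_0_iff)
  have Flip: "F c x \<le> F c y + d x y" if "x \<in> M" "y \<in> M" "c \<in> M" for c x y
    using that triangle[of b y x] triangle[of c y x] commute[of x y] assms by (auto simp: F_def)
  have Fa: "F c a = d a b" and Fb: "F c b = 0" if "c \<in> M" for c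
    using that triangle[of c b a] commute[of b a] assms by (auto simp: F_def)
  \<comment> \<open>For the pair \<open>x\<close>, \<open>y\<close> the summand \<open>c = x\<close>
    is the strict one. Strictness could fail only if the path \<open>a\<close>, \<open>x\<close>,
    \<open>y\<close>, \<open>b\<close> were a geodesic; as nothing lies between \<open>a\<close> and
    \<open>b\<close>, this leaves only the excluded case \<open>x = a\<close>,
    \<open>y = b\<close>.\<close>
  have Fstrict: "F x x < F x y + d x y" if "x \<in> M" "y \<in> M" "x \<noteq> y" "\<not> (x = a \<and> y = b)" for x y
  proof -
    have "d a b < d x a + d x y + d b y"
    proof (rule ccontr)
      assume *: "\<not> ?thesis"
      have xy: "d x y > 0" using that by (simp add: order_less_le)
      have "d x b \<le> d x y + d b y" using triangle[of x y b] that assms commute[of b y] by simp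
      moreover have "d a b \<le> d a x + d x b" using triangle that assms by simp
      ultimately have eq: "d a b = d a x + d x b" "d x b = d x y + d b y"
        using * commute[of x a] by linarith+
      have "x = a \<or> x = b" using nobetw[of x] eq that assms by (auto simp: lies_between_def)
      then show False
      proof
        assume "x = a"
        then have "lies_between d a y b" using that eq assms commute[of b y]
          by (auto simp: lies_between_def)
        then show False using nobetw that by blast
      next
        assume "x = b"
        then show False using eq xy assms nonneg[of b y] by simp
      qed
    qed
    moreover have "d x y > 0" using that by (simp add: order_less_le)
    moreover have "d x x = 0" using that by simp
    ultimately show ?thesis unfolding F_def by linarith
  qed
  show ?thesis
  proof (intro exI[of _ f] conjI ballI impI)
    have fd: "f x \<le> f y + d x y \<longleftrightarrow> (\<Sum>c\<in>M. F c x) \<le> (\<Sum>c\<in>M. F c y + d x y)"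
      "f x = f y + d x y \<longleftrightarrow> (\<Sum>c\<in>M. F c x) = (\<Sum>c\<in>M. F c y + d x y)" for x y
      using cpos by (simp_all add: f_def sum.distrib field_simps)
    show "f x \<le> f y + d x y" if "x \<in> M" "y \<in> M" for x y
      unfolding fd using that by (intro sum_mono Flip)
    show "f a = f b + d a b"
      unfolding fd by (intro sum.cong) (auto simp: Fa Fb)
    fix x y assume that: "x \<in> M" "y \<in> M" "f x = f y + d x y" "x \<noteq> y"
    have "x = a \<and> y = b"
    proof (rule ccontr)
      assume "\<not> (x = a \<and> y = b)"
      then have "(\<Sum>c\<in>M. F c x) < (\<Sum>c\<in>M. F c y + d x y)"
        using that assms(1) Flip Fstrict by (intro sum_strict_mono_ex1) blast+
      then show False using that(3) unfolding fd by simp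
    qed
    then show "x = a" "y = b" by simp_all
  qed
qed

text \<open>\<open>b\<close> becomes the middle point and \<open>v a\<close> the long side.
  Therefore \<open>priv\<close> ranges over all edges of \<open>E\<close> through \<open>v\<close>
  and \<open>a\<close>, while \<open>deg\<close> concerns only the edges induced so far.\<close>

lemma realizable_insert_edge:
  assumes "realizable E U" "finite U" "v \<notin> U" "{v, a, b} \<in> E" "a \<in> U" "b \<in> U" "a \<noteq> b"
    and deg: "\<And>e. e \<in> E \<Longrightarrow> v \<in> e \<Longrightarrow> e \<subseteq> insert v U \<Longrightarrow> e = {v, a, b}"
    and priv: "\<And>e. e \<in> E \<Longrightarrow> v \<in> e \<Longrightarrow> a \<in> e \<Longrightarrow> e = {v, a, b}"
  shows "realizable E (insert v U)"
proof -
  obtain d where d: "realizes E U d"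
    using assms(1) unfolding realizable_def by blast
  interpret Metric_space U d using d by (simp add: realizes_def)
  \<comment> \<open>A point between \<open>a\<close> and \<open>b\<close> would reserve the side
    \<open>a b\<close> for an edge inside \<open>U\<close>, but \<open>{v, a, b}\<close> also
    contains that side.\<close>
  have "\<not> lies_between d a c b" if "c \<in> U" for c
  proof
    assume "lies_between d a c b"
    then have "\<forall>e\<in>E. a \<in> e \<longrightarrow> b \<in> e \<longrightarrow> e = {a, c, b}"
      using d that assms(5,6) by (simp add: realizes_def)
    then have "{v, a, b} = {a, c, b}" using assms(4) by simp
    moreover have "v \<notin> {a, c, b}" using that assms(3,5,6) by auto
    ultimately show False by blast
  qed
  from ex_nonexpansive_strict[OF assms(2,5,6,7) this]
  obtain f where f: "\<forall>x\<in>U. \<forall>y\<in>U. f x \<le> f y + d x y" "f a = f b + d a b"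
    "\<forall>x\<in>U. \<forall>y\<in>U. f x = f y + d x y \<longrightarrow> x \<noteq> y \<longrightarrow> x = a \<and> y = b"
    by blast
  obtain K where K: "K > 0" "\<forall>x\<in>U. \<forall>y\<in>U. d x y < K"
    using finite_bounded[OF assms(2)] by blast
  \<comment> \<open>Nonexpansiveness gives \<open>f x - f b > - K\<close>, so the shift by
    \<open>2 * K\<close> lifts all values on \<open>U\<close> above \<open>K\<close>, which makes
    \<open>kat\<close> strict. Off \<open>U\<close> any nonnegative value would do.\<close>
  define g where "g x = (if x \<in> U then f x - f b + 2 * K else 0)" for x
  have gK: "g x > K" if "x \<in> U" for x
    using f(1)[rule_format, of b x] K(2)[rule_format, of b x] that assms(6) by (simp add: g_def)
  show ?thesis
  proof (rule realizable_insert[where g = g and d = d])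
    show "g c \<ge> 0" for c using gK[of c] K by (cases "c \<in> U") (auto simp: g_def)
    show "g c > 0" if "c \<in> U" for c using gK[of c] K that by simp
    show "d x y < g x + g y" if "x \<in> U" "y \<in> U" for x y
      using gK[of x] gK[of y] K(1) K(2)[rule_format, of x y] that by simp
    show "g x \<le> g y + d x y" if "x \<in> U" "y \<in> U" for x y
      using f(1)[rule_format, of x y] that by (simp add: g_def)
    show "{v, y, x} \<in> E \<and> (\<forall>e\<in>E. v \<in> e \<longrightarrow> x \<in> e \<longrightarrow> e = {v, y, x})"
      if "x \<in> U" "y \<in> U" "x \<noteq> y" "g x = g y + d x y" for x y
    proof -
      have "x = a \<and> y = b" using f(3)[rule_format, of x y] that by (simp add: g_def)
      then show ?thesis using assms(4) priv by (metis insert_commute)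
    qed
    show "\<exists>x\<in>U. \<exists>y\<in>U. x \<noteq> y \<and> e = {v, y, x} \<and> g x = g y + d x y"
      if "e \<in> E" "v \<in> e" "e \<subseteq> insert v U" for e
      using deg[OF that] f(2) assms(5-7)
      by (intro bexI[of _ a] bexI[of _ b]) (auto simp: g_def)
  qed (fact d assms(3))+
qed

section \<open>Degree counting\<close>

definition induced_edges :: "'a set set \<Rightarrow> 'a set \<Rightarrow> 'a set set" where
  "induced_edges E U = {e \<in> E. e \<subseteq> U}"

text \<open>Double counting of incidences between the vertices outside \<open>S\<close> and the
  edges not inside \<open>S\<close>: every edge at such a vertex is counted, and an edge has at most
  three such vertices.\<close>

lemma degree_sum_outside:
  assumes "finite U" "S \<subseteq> U" "\<And>e. e \<in> E \<Longrightarrow> card e = 3"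
    and deg: "\<And>x. x \<in> U - S \<Longrightarrow> 2 \<le> card {e \<in> induced_edges E U. x \<in> e}"
  shows "2 * (card U - card S) \<le> 3 * (card (induced_edges E U) - card (induced_edges E S))"
proof -
  let ?D = "induced_edges E U - induced_edges E S"
  have fin: "finite (induced_edges E U)"
    using assms(1) by (auto simp: induced_edges_def intro: finite_subset[of _ "Pow U"])
  have sub: "induced_edges E S \<subseteq> induced_edges E U"
    using assms(2) by (auto simp: induced_edges_def)
  have "2 * (card U - card S) = (\<Sum>x\<in>U - S. 2)"
    using assms(1,2) by (simp add: card_Diff_subset finite_subset)
  also have "\<dots> \<le> (\<Sum>x\<in>U - S. card {e \<in> ?D. x \<in> e})"
  proof (rule sum_mono)
    fix x assume x: "x \<in> U - S"
    then have "{e \<in> ?D. x \<in> e} = {e \<in> induced_edges E U. x \<in> e}"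
      by (auto simp: induced_edges_def)
    then show "2 \<le> card {e \<in> ?D. x \<in> e}" using deg[OF x] by simp
  qed
  also have "\<dots> = (\<Sum>e\<in>?D. card {x \<in> U - S. x \<in> e})"
    using sum.swap[of "\<lambda>x e. if x \<in> e then 1 else (0::nat)" ?D "U - S"] fin assms(1)
    by (simp add: sum.If_cases Int_def card_eq_sum del: sum_constant)
  also have "\<dots> \<le> (\<Sum>e\<in>?D. 3)"
  proof (rule sum_mono)
    fix e assume "e \<in> ?D"
    then have "card e = 3" using assms(3) by (auto simp: induced_edges_def)
    moreover then have "finite e" by (metis card.infinite zero_neq_numeral)
    ultimately show "card {x \<in> U - S. x \<in> e} \<le> 3"
      using card_mono[of e "{x \<in> U - S. x \<in> e}"] by auto
  qed
  also have "\<dots> = 3 * (card (induced_edges E U) - card (induced_edges E S))"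
    using fin sub by (simp add: card_Diff_subset finite_subset)
  finally show ?thesis .
qed

lemma obtain_third:
  assumes "card e = 3" "x \<in> e" "y \<in> e" "x \<noteq> y"
  obtains z where "e = {x, y, z}" "z \<noteq> x" "z \<noteq> y"
proof -
  obtain p q t where "e = {p, q, t}" "p \<noteq> q" "p \<noteq> t" "q \<noteq> t"
    using assms(1) by (auto simp: card_3_iff)
  with assms(2-4) that show ?thesis by (auto simp: insert_commute)
qed

section \<open>Half-sparse hypergraphs: low degrees, forks and insertion\<close>

text \<open>The bound \<open>f0\<close> in doubled form, extended to sets of fewer than four
  vertices so that it applies uniformly.\<close>

locale half_sparse =
  fixes V :: "'a set" and E :: "'a set set"
  assumes finite_V: "finite V"
    and edge_subset: "e \<in> E \<Longrightarrow> e \<subseteq> V"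
    and card_edge: "e \<in> E \<Longrightarrow> card e = 3"
    and half_sparse: "U \<subseteq> V \<Longrightarrow> 2 * card (induced_edges E U) \<le> card U + 1"
begin

lemma card_edges_le:
  assumes "F \<subseteq> E" "\<And>e. e \<in> F \<Longrightarrow> e \<subseteq> W" "W \<subseteq> V"
  shows "2 * card F \<le> card W + 1"
proof -
  have "finite (induced_edges E W)"
    using assms(3) finite_V by (auto simp: induced_edges_def intro: finite_subset[of _ "Pow W"] finite_subset)
  then have "card F \<le> card (induced_edges E W)"
    using assms by (intro card_mono) (auto simp: induced_edges_def)
  then show ?thesis using half_sparse[OF assms(3)] by linarith
qed

text \<open>Let \<open>U\<close> have \<open>k\<close> vertices and \<open>m\<close> edges, and
  suppose all degrees outside \<open>S\<close> are at least 2. For \<open>S = {}\<close>,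
  \<open>2 k \<le> 3 m\<close> and \<open>2 m \<le> k + 1\<close> give \<open>k \<le> 3\<close>. For
  the five-vertex \<open>S\<close>, \<open>2 (k - 5) \<le> 3 (m - 3)\<close> gives
  \<open>k \<le> 5\<close>, contradicting \<open>S \<subset> U\<close>.\<close>

lemma ex_degree_le_1:
  assumes "S \<subset> U" "U \<subseteq> V"
    and S: "S = {} \<or> card S = 5 \<and> card (induced_edges E S) \<ge> 3"
  shows "\<exists>x\<in>U - S. card {e \<in> induced_edges E U. x \<in> e} \<le> 1"
proof (rule ccontr)
  assume "\<not> ?thesis"
  then have "2 \<le> card {e \<in> induced_edges E U. x \<in> e}" if "x \<in> U - S" for x
    using that by force
  moreover have fin: "finite U" using assms finite_V finite_subset by blast
  ultimately have le: "2 * (card U - card S) \<le> 3 * (card (induced_edges E U) - card (induced_edges E S))"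
    using assms(1) card_edge by (intro degree_sum_outside) auto
  have m: "2 * card (induced_edges E U) \<le> card U + 1" using half_sparse assms(2) by blast
  have lt: "card S < card U" using fin assms(1) by (rule psubset_card_mono)
  from S show False
  proof
    assume "S = {}"
    then have U: "2 * card U \<le> 3 * card (induced_edges E U)" "card U > 0" using le lt by auto
    then have U3: "card U \<le> 3" using m by linarith
    \<comment> \<open>On at most three vertices only \<open>U\<close> itself can be an edge. One
      edge is too few for degree 2 on three vertices, so \<open>U\<close> is a single vertex with no
      edge at all.\<close>
    have "induced_edges E U \<subseteq> {U}"
    proof
      fix e assume "e \<in> induced_edges E U"
      then have "e \<subseteq> U" "card e = 3" using card_edge by (auto simp: induced_edges_def)
      then have "e = U" using U3 fin by (intro card_seteq) auto
      then show "e \<in> {U}" by simp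
    qed
    then have "card (induced_edges E U) \<le> 1"
      using card_mono[of "{U}" "induced_edges E U"] by simp
    then have "card U \<le> 1" using U by linarith
    have "induced_edges E U = {}"
    proof (rule equals0I)
      fix e assume "e \<in> induced_edges E U"
      then have "e \<subseteq> U" "card e = 3" using card_edge by (auto simp: induced_edges_def)
      then show False using card_mono[OF fin, of e] \<open>card U \<le> 1\<close> by simp
    qed
    then show False using U by simp
  next
    assume "card S = 5 \<and> card (induced_edges E S) \<ge> 3"
    then show False using le lt m by linarith
  qed
qed

text \<open>A fork is the obstruction to choosing either \<open>v a\<close> or \<open>v b\<close> as the long side of
  the edge \<open>{v, a, b}\<close>.\<close>

definition fork :: "'a \<Rightarrow> 'a \<Rightarrow> 'a \<Rightarrow> 'a \<Rightarrow> 'a \<Rightarrow> bool" where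
  "fork v a b w u \<longleftrightarrow> distinct [v, a, b, w, u] \<and>
     {v, a, b} \<in> E \<and> {v, a, w} \<in> E \<and> {v, b, u} \<in> E"

lemma fork_card:
  assumes "fork v a b w u"
  shows "card {v, a, b, w, u} = 5" "card {{v, a, b}, {v, a, w}, {v, b, u}} = 3"
    "{{v, a, b}, {v, a, w}, {v, b, u}} \<subseteq> E"
proof -
  have d: "distinct [v, a, b, w, u]" and E: "{v, a, b} \<in> E" "{v, a, w} \<in> E" "{v, b, u} \<in> E"
    using assms by (simp_all add: fork_def)
  then have "w \<notin> {v, a, b}" "a \<notin> {v, b, u}" by auto
  then have "{v, a, b} \<noteq> {v, a, w}" "{v, a, b} \<noteq> {v, b, u}" "{v, a, w} \<noteq> {v, b, u}" by blast+
  then show "card {{v, a, b}, {v, a, w}, {v, b, u}} = 3" by simp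
  show "card {v, a, b, w, u} = 5" using d by simp
  show "{{v, a, b}, {v, a, w}, {v, b, u}} \<subseteq> E" using E by simp
qed

text \<open>If \<open>v\<close> has an induced edge \<open>{v, a, b}\<close>, either
  \<open>v a\<close> or \<open>v b\<close> may serve as its long side. When both fail, the blocking
  edges, possibly reaching outside \<open>insert v U\<close>, complete a fork.\<close>

lemma realizable_insert_or_fork:
  assumes "realizable E U" "v \<notin> U" "insert v U \<subseteq> V"
    and deg: "card {e \<in> induced_edges E (insert v U). v \<in> e} \<le> 1"
  shows "realizable E (insert v U) \<or> (\<exists>a b w u. fork v a b w u)"
proof (cases "\<exists>e\<in>E. v \<in> e \<and> e \<subseteq> insert v U")
  case False
  have "finite U" using finite_subset[OF assms(3) finite_V] by simp
  then have "realizable E (insert v U)"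
    using False by (intro realizable_insert_free[OF assms(1) _ assms(2)]) auto
  then show ?thesis ..
next
  case True
  have finU: "finite U" using finite_subset[OF assms(3) finite_V] by simp
  obtain e where e: "e \<in> E" "v \<in> e" "e \<subseteq> insert v U" using True by blast
  have "e \<noteq> {v}" using card_edge[OF e(1)] by auto
  then obtain a where a: "a \<in> e" "a \<noteq> v" using e(2) by blast
  obtain b where b: "e = {v, a, b}" "b \<noteq> v" "b \<noteq> a"
    using obtain_third[OF card_edge[OF e(1)] e(2) a(1)] a(2) by metis
  have b': "e = {v, b, a}" using b(1) by blast
  have U: "a \<in> U" "b \<in> U" using e(3) a b by auto
  have fin: "finite {e \<in> induced_edges E (insert v U). v \<in> e}"
    using finU by (auto simp: induced_edges_def intro: finite_subset[of _ "Pow (insert v U)"])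
  have uniq: "e' = e" if "e' \<in> E" "v \<in> e'" "e' \<subseteq> insert v U" for e'
    using deg card_le_Suc0_iff_eq[OF fin] that e by (simp add: induced_edges_def)
  have priv: "realizable E (insert v U)"
    if c: "e = {v, c, c'}" "c \<in> U" "c' \<in> U" "c \<noteq> c'"
      and only: "\<not> (\<exists>e'\<in>E. v \<in> e' \<and> c \<in> e' \<and> e' \<noteq> e)" for c c'
  proof (rule realizable_insert_edge[OF assms(1) finU assms(2) _ c(2-4)])
    show "{v, c, c'} \<in> E" using e(1) c(1) by simp
    show "e' = {v, c, c'}" if "e' \<in> E" "v \<in> e'" "e' \<subseteq> insert v U" for e'
      using uniq[OF that] c(1) by simp
    show "e' = {v, c, c'}" if "e' \<in> E" "v \<in> e'" "c \<in> e'" for e'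
      using only that c(1) by blast
  qed
  show ?thesis
  proof (rule ccontr)
    assume neg: "\<not> ?thesis"
    have "\<exists>e'\<in>E. v \<in> e' \<and> a \<in> e' \<and> e' \<noteq> e"
      using priv[OF b(1) U] b(3) neg by blast
    then obtain e2 where e2: "e2 \<in> E" "v \<in> e2" "a \<in> e2" "e2 \<noteq> e" by blast
    obtain w where w: "e2 = {v, a, w}" "w \<noteq> v" "w \<noteq> a"
      using obtain_third[OF card_edge[OF e2(1)] e2(2,3)] a(2) by metis
    have "\<exists>e'\<in>E. v \<in> e' \<and> b \<in> e' \<and> e' \<noteq> e"
      using priv[OF b' U(2,1)] b(3) neg by blast
    then obtain e3 where e3: "e3 \<in> E" "v \<in> e3" "b \<in> e3" "e3 \<noteq> e" by blast
    obtain u where u: "e3 = {v, b, u}" "u \<noteq> v" "u \<noteq> b"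
      using obtain_third[OF card_edge[OF e3(1)] e3(2,3)] b(2) by metis
    have wb: "w \<noteq> b" and ua: "u \<noteq> a" using w u b e2(4) e3(4) by (auto simp: insert_commute)
    \<comment> \<open>Otherwise three edges would lie on four vertices, giving
      \<open>6 \<le> 5\<close>.\<close>
    have "w \<noteq> u"
    proof
      assume "w = u"
      then have "2 * card {e, e2, e3} \<le> card {v, a, b, w} + 1"
        using e(1) e2(1) e3(1) edge_subset b w u by (intro card_edges_le) auto
      moreover have "b \<notin> e2" using w b wb by auto
      then have "e2 \<noteq> e3" using e3(3) by blast
      then have "card {e, e2, e3} = 3" using e2(4) e3(4) by simp
      moreover have "card {v, a, b, w} \<le> 4" by (simp add: card_insert_if)
      ultimately show False by linarith
    qed
    then have "fork v a b w u"
      using e(1) e2(1) e3(1) a(2) b w u wb ua by (simp add: fork_def)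
    with neg show False by blast
  qed
qed

text \<open>Vertices of degree at most 1 are peeled off down to \<open>S\<close> and reinserted in
  reverse order. Since every fork is centred in \<open>S\<close>, no insertion is blocked.\<close>

lemma realizable_grow:
  assumes "S \<subseteq> U" "U \<subseteq> V" "realizable E S"
    and S: "S = {} \<or> card S = 5 \<and> card (induced_edges E S) \<ge> 3"
    and fork: "\<And>v a b w u. fork v a b w u \<Longrightarrow> v \<in> S"
  shows "realizable E U"
  using assms(1,2)
proof (induction "card U" arbitrary: U)
  case 0
  then have "U = {}" using finite_V finite_subset card_0_eq by metis
  then show ?case using 0 assms(3) by simp
next
  case (Suc n)
  show ?case
  proof (cases "U = S")
    case True
    then show ?thesis using assms(3) by simp
  next
    case False
    then obtain x where x: "x \<in> U" "x \<notin> S" "card {e \<in> induced_edges E U. x \<in> e} \<le> 1"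
      using ex_degree_le_1[of S U] Suc.prems S by blast
    have ins: "insert x (U - {x}) = U" using x by blast
    have "card (U - {x}) = n" using x Suc.hyps(2) by simp
    then have "realizable E (U - {x})" using Suc.hyps(1) Suc.prems x by blast
    then show ?thesis
      using realizable_insert_or_fork[of "U - {x}" x] ins x Suc.prems(2) fork
      by (metis DiffD2 insertI1)
  qed
qed

section \<open>The configuration around a fork\<close>

text \<open>A further edge with at most one vertex outside the fork would make four edges on at most
  six vertices, giving \<open>8 \<le> 7\<close>.\<close>

lemma induced_by_fork:
  assumes "fork v a b w u" "e \<in> E" "card (e - {v, a, b, w, u}) \<le> 1"
  shows "e \<in> {{v, a, b}, {v, a, w}, {v, b, u}}"
proof (rule ccontr)
  let ?F = "{{v, a, b}, {v, a, w}, {v, b, u}}"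
  assume "e \<notin> ?F"
  note f = fork_card[OF assms(1)]
  have "2 * card (insert e ?F) \<le> card ({v, a, b, w, u} \<union> (e - {v, a, b, w, u})) + 1"
    using assms(2) f(3) edge_subset by (intro card_edges_le) blast+
  moreover have "card (insert e ?F) = 4" using \<open>e \<notin> ?F\<close> f(2) by simp
  moreover have "card ({v, a, b, w, u} \<union> (e - {v, a, b, w, u})) \<le> 6"
    using card_Un_le[of "{v, a, b, w, u}" "e - {v, a, b, w, u}"] assms(3) f(1) by linarith
  ultimately show False by linarith
qed

lemma induced_by_fork_subset:
  assumes "fork v a b w u" "e \<in> E" "e \<subseteq> {v, a, b, w, u}"
  shows "e \<in> {{v, a, b}, {v, a, w}, {v, b, u}}"
proof -
  have "e - {v, a, b, w, u} = {}" using assms(3) by blast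
  then have "card (e - {v, a, b, w, u}) \<le> 1" by (simp only: card.empty)
  then show ?thesis by (rule induced_by_fork[OF assms(1,2)])
qed

text \<open>Controls edges leaving the fork as well, as is required to reserve long sides with
  respect to all of \<open>E\<close>.\<close>

lemma induced_by_fork_pair:
  assumes "fork v a b w u" "e \<in> E" "x \<in> e" "y \<in> e" "x \<noteq> y" "{x, y} \<subseteq> {v, a, b, w, u}"
  shows "e \<in> {{v, a, b}, {v, a, w}, {v, b, u}}"
proof -
  obtain z where "e = {x, y, z}"
    using obtain_third[OF card_edge[OF assms(2)] assms(3-5)] .
  then have "e - {v, a, b, w, u} \<subseteq> {z}" using assms(6) by blast
  then have "card (e - {v, a, b, w, u}) \<le> 1" using card_mono[of "{z}"] by fastforce
  then show ?thesis by (rule induced_by_fork[OF assms(1,2)])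
qed

lemma not_edge_subset_pair: "e \<in> E \<Longrightarrow> \<not> e \<subseteq> {x, y}"
  using card_edge[of e] card_mono[of "{x, y}" e] by (auto simp: card_insert_if split: if_splits)

lemma realizable_empty: "realizable E {}"
proof -
  have "realizes E {} (\<lambda>_ _. 0)"
    using not_edge_subset_pair by (auto simp: realizes_def Metric_space_def)
  then show ?thesis unfolding realizable_def by blast
qed

text \<open>Insertion in the order \<open>v\<close>, \<open>a\<close>, \<open>w\<close>,
  \<open>b\<close>, \<open>u\<close> with long sides \<open>w v\<close>, \<open>b a\<close>,
  \<open>u v\<close>. Each of these pairs lies in one edge only, whereas \<open>v a\<close> and
  \<open>v b\<close> lie in two.\<close>

lemma realizable_fork:
  assumes "fork v a b w u"
  shows "realizable E {v, a, b, w, u}"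
proof -
  have d: "v \<noteq> a" "v \<noteq> b" "v \<noteq> w" "v \<noteq> u" "a \<noteq> b" "a \<noteq> w" "a \<noteq> u" "b \<noteq> w" "b \<noteq> u" "w \<noteq> u"
    and E: "{v, a, b} \<in> E" "{v, a, w} \<in> E" "{v, b, u} \<in> E"
    using assms by (auto simp: fork_def)
  note sub = induced_by_fork_subset[OF assms] and pair = induced_by_fork_pair[OF assms]
  have "realizable E {v}"
    using realizable_empty not_edge_subset_pair[of _ v v]
    by (intro realizable_insert_free[where U = "{}"]) auto
  then have "realizable E {a, v}"
    using d not_edge_subset_pair[of _ a v] by (intro realizable_insert_free[where U = "{v}"]) auto
  then have "realizable E {w, a, v}"
  proof (rule realizable_insert_edge[where a = v and b = a])
    show "e = {w, v, a}" if "e \<in> E" "w \<in> e" "e \<subseteq> {w, a, v}" for e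
      using sub[OF that(1)] that(2,3) d by auto
    show "e = {w, v, a}" if "e \<in> E" "w \<in> e" "v \<in> e" for e
      using pair[OF that] that(2,3) d by auto
  qed (use d E in \<open>auto simp: insert_commute\<close>)
  then have "realizable E {b, w, a, v}"
  proof (rule realizable_insert_edge[where a = a and b = v])
    show "e = {b, a, v}" if "e \<in> E" "b \<in> e" "e \<subseteq> {b, w, a, v}" for e
      using sub[OF that(1)] that(2,3) d by auto
    show "e = {b, a, v}" if "e \<in> E" "b \<in> e" "a \<in> e" for e
      using pair[OF that] that(2,3) d by auto
  qed (use d E in \<open>auto simp: insert_commute\<close>)
  then have "realizable E {u, b, w, a, v}"
  proof (rule realizable_insert_edge[where a = v and b = b])
    show "e = {u, v, b}" if "e \<in> E" "u \<in> e" "e \<subseteq> {u, b, w, a, v}" for e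
      using sub[OF that(1)] that(2,3) d by auto
    show "e = {u, v, b}" if "e \<in> E" "u \<in> e" "v \<in> e" for e
      using pair[OF that] that(2,3) d by auto
  qed (use d E in \<open>auto simp: insert_commute\<close>)
  then show ?thesis by (simp add: insert_commute)
qed

text \<open>If \<open>v'\<close> were outside, it would be in all three edges of its own fork and in
  none of the other. Six edges on at most ten vertices would give
  \<open>12 \<le> 11\<close>.\<close>

lemma fork_unique:
  assumes f: "fork v a b w u" and f': "fork v' a' b' w' u'"
  shows "v' \<in> {v, a, b, w, u}"
proof (rule ccontr)
  assume v': "v' \<notin> {v, a, b, w, u}"
  let ?F = "{{v, a, b}, {v, a, w}, {v, b, u}}"
    and ?F' = "{{v', a', b'}, {v', a', w'}, {v', b', u'}}"
  have "2 * card (?F \<union> ?F') \<le> card ({v, a, b, w, u} \<union> {v', a', b', w', u'}) + 1"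
  proof (rule card_edges_le)
    show sub: "?F \<union> ?F' \<subseteq> E" using fork_card(3)[OF f] fork_card(3)[OF f'] by blast
    have "{v, a, b, w, u} \<union> {v', a', b', w', u'} = \<Union>(?F \<union> ?F')" by auto
    moreover have "\<Union>(?F \<union> ?F') \<subseteq> V"
      using subsetD[OF sub] edge_subset by (intro Union_least) simp
    ultimately show "{v, a, b, w, u} \<union> {v', a', b', w', u'} \<subseteq> V" by (simp only:)
  qed auto
  moreover have "?F \<inter> ?F' = {}" using v' by auto
  then have "card (?F \<union> ?F') = card ?F + card ?F'" by (intro card_Un_disjoint) auto
  then have "card (?F \<union> ?F') = 6" using fork_card(2)[OF f] fork_card(2)[OF f'] by linarith
  moreover have "card ({v, a, b, w, u} \<union> {v', a', b', w', u'}) \<le> 5 + 5"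
    by (rule order.trans[OF card_Un_le]) (simp only: fork_card(1)[OF f] fork_card(1)[OF f'])
  ultimately show False by linarith
qed

lemma realizable_V: "realizable E V"
proof (cases "\<exists>v a b w u. fork v a b w u")
  case False
  then show ?thesis using realizable_grow[of "{}" V] realizable_empty by blast
next
  case True
  then obtain v a b w u where f: "fork v a b w u" by blast
  let ?S = "{v, a, b, w, u}" and ?F = "{{v, a, b}, {v, a, w}, {v, b, u}}"
  have F: "?F \<subseteq> induced_edges E ?S"
    using fork_card(3)[OF f] by (simp add: induced_edges_def)
  have "finite (induced_edges E ?S)"
    by (auto simp: induced_edges_def intro: finite_subset[of _ "Pow ?S"])
  from card_mono[OF this F] have "card (induced_edges E ?S) \<ge> 3" using fork_card(2)[OF f] by linarith
  moreover have "{v, a, b} \<subseteq> V" "{v, a, w} \<subseteq> V" "{v, b, u} \<subseteq> V"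
    using f unfolding fork_def by (intro edge_subset; blast)+
  then have "?S \<subseteq> V" by blast
  ultimately show ?thesis
    by (intro realizable_grow[OF _ order_refl realizable_fork[OF f]] disjI2 conjI
        fork_card(1)[OF f] fork_unique[OF f])
qed

end

section \<open>From sparsity to the metric\<close>

lemma sparse_hypergraph_half_sparse:
  assumes "three_uniform H" "finite (fst H)" "sparse_hypergraph f0 H"
  shows "half_sparse (fst H) (snd H)"
proof
  show "finite (fst H)" by fact
  show "e \<subseteq> fst H" "card e = 3" if "e \<in> snd H" for e
    using assms(1) that by (auto simp: three_uniform_def)
  fix U assume U: "U \<subseteq> fst H"
  then have fin: "finite U" using assms(2) finite_subset by blast
  show "2 * card (induced_edges (snd H) U) \<le> card U + 1"
  proof (cases "card U \<ge> 4")
    case True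
    then have "card {e \<in> snd H. e \<subseteq> U} \<le> f0 (card U)"
      using assms(2,3) U card_mono[OF assms(2) U] by (simp add: sparse_hypergraph_def)
    moreover have "2 * f0 (card U) \<le> card U + 1" unfolding f0_def by linarith
    ultimately show ?thesis by (simp add: induced_edges_def)
  next
    case False
    \<comment> \<open>Sparsity is silent below four vertices; there a triple inside \<open>U\<close>
      must be \<open>U\<close> itself.\<close>
    have "e = U \<and> card U = 3" if "e \<in> induced_edges (snd H) U" for e
    proof -
      have "e \<subseteq> U" "card e = 3"
        using that assms(1) by (auto simp: induced_edges_def three_uniform_def)
      then show ?thesis using False card_seteq[OF fin, of e] by auto
    qed
    then have "induced_edges (snd H) U \<subseteq> (if card U = 3 then {U} else {})" by auto
    then have "card (induced_edges (snd H) U) \<le> card (if card U = 3 then {U} else {})"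
      by (intro card_mono) auto
    then show ?thesis by (auto split: if_splits)
  qed
qed

theorem theorem2:
  fixes H :: "'a hypergraph" and n :: nat
  assumes "three_uniform H"
    and "finite (fst H)"
    and "card (fst H) = n"
    and "sparse_hypergraph f0 H"
  shows "metric_hypergraph H"
proof -
  interpret half_sparse "fst H" "snd H"
    using assms(1,2,4) by (rule sparse_hypergraph_half_sparse)
  obtain d where d: "realizes (snd H) (fst H) d"
    using realizable_V unfolding realizable_def by blast
  have "e \<in> snd H" if e: "e \<subseteq> fst H" "collinear_triple d e" for e
  proof -
    obtain x y z where "e = {x, y, z}" "lies_between d x y z"
      using e(2) unfolding collinear_triple_def by blast
    then show ?thesis using d e(1) by (simp add: realizes_def)
  qed
  \<comment> \<open>The converse inclusion uses that every edge lies in the whole vertex set, so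
    \<open>realizes\<close> makes it collinear.\<close>
  then have "hypergraph_of_metric (fst H) d = H"
    using d edge_subset by (auto simp: hypergraph_of_metric_def realizes_def prod_eq_iff)
  then show ?thesis
    using d unfolding metric_hypergraph_def realizes_def by (intro exI[of _ "fst H"] exI[of _ d]) simp
qed

end
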